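(* Let $r\ge 1$ and let $\zeta$ be an $r$-th root of unity. Let $\alpha=\alpha^{(1)}\cdot\alpha^{(2)}\cdots\alpha^{(k)}$ be any decomposition of a composition $\alpha$ as a concatenation of compositions such that for $1\le i\le k-1$, $\alpha^{(i)}$ is a composition of a multiple of $r$. Then $$\mathbf{H}_\alpha^{\zeta}=\mathbf{H}_{\alpha^{(1)}}^\zeta\,\mathbf{H}_{\alpha^{(2)}}^\zeta\cdots\mathbf{H}_{\alpha^{(k)}}^\zeta ,$$ where $\mathbf{H}_\alpha^{\zeta}$ denotes the specialization at $q=\zeta$ of $\mathbf{H}_\alpha^q=\sum_{\beta\ge\alpha} q^{c(\alpha,\beta^c)}\,\mathbf{s}_\beta$.
   Context: A composition $\alpha$ of a positive integer $n$ ($\alpha\models n$) is a sequence $(\alpha_1,\dots,\alpha_\ell)$ of positive integers with sum $n$; $|\alpha|=n$, $\ell(\alpha)=\ell$. The concatenation is $\alpha\cdot\beta=(\alpha_1,\dots,\alpha_{\ell(\alpha)},\beta_1,\dots,\beta_{\ell(\beta)})$. The descent set is $D(\alpha)=\{\alpha_1,\alpha_1+\alpha_2,\dots,\alpha_1+\cdots+\alpha_{\ell-1}\}\subseteq\{1,\dots,n-1\}$; $\alpha\mapsto D(\alpha)$ is a bijection onto subsets of $\{1,\dots,n-1\}$. For compositions of the same $n$, $\alpha\le\beta$ (equivalently $\beta\ge\alpha$) means $D(\beta)\subseteq D(\alpha)$. The composition $\alpha^c$ of $n$ is defined by $D(\alpha^c)=\{1,\dots,n-1\}\setminus D(\alpha)$.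 For $\alpha,\beta\models n$, $c(\alpha,\beta)=\sum_{i\in D(\alpha)\cap D(\beta)} i$. $NC\Lambda$ is the free associative algebra on $\mathbf{h}_1,\mathbf{h}_2,\dots$ over $\mathbb{Q}$; here coefficients are extended to a field containing $\zeta$ (e.g. $\mathbb{C}$). Put $\mathbf{h}_\alpha=\mathbf{h}_{\alpha_1}\cdots\mathbf{h}_{\alpha_\ell}$. The ribbon Schur functions are $\mathbf{s}_\alpha=\sum_{\beta\ge\alpha}(-1)^{\ell(\alpha)-\ell(\beta)}\mathbf{h}_\beta$. *)

theory Defs
  imports "HOL-Library.Poly_Mapping" "HOL-Computational_Algebra.Polynomial"
begin

section \<open>Compositions\<close>

text \<open>
  The type also contains the empty sequence (the composition of 0). It is the neutral
  element for concatenation and indexes the unit of the algebra below.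
\<close>

typedef composition = "{xs :: nat list. 0 \<notin> set xs}"
  morphisms parts Composition
  by (rule exI[of _ "[]"]) simp

setup_lifting type_definition_composition

text \<open>Addition of compositions is concatenation, so it is not commutative.\<close>

instantiation composition :: monoid_add
begin

lift_definition zero_composition :: composition is "[]" by simp

lift_definition plus_composition :: "composition \<Rightarrow> composition \<Rightarrow> composition" is "(@)"
  by simp

instance by standard (transfer, simp)+

end

definition weight :: "composition \<Rightarrow> nat" where
  "weight \<alpha> = sum_list (parts \<alpha>)"

definition len :: "composition \<Rightarrow> nat" where
  "len \<alpha> = length (parts \<alpha>)"

definition partial_sums :: "nat list \<Rightarrow> nat set" where
  "partial_sums xs = (\<lambda>i. sum_list (take i xs)) ` {1..<length xs}"

definition descents :: "composition \<Rightarrow> nat set" where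
  "descents \<alpha> = partial_sums (parts \<alpha>)"

lemma partial_sums_Nil [simp]: "partial_sums [] = {}"
  by (simp add: partial_sums_def)

lemma partial_sums_single [simp]: "partial_sums [a] = {}"
  by (simp add: partial_sums_def)

lemma partial_sums_Cons:
  assumes "xs \<noteq> []"
  shows "partial_sums (a # xs) = insert a ((+) a ` partial_sums xs)"
proof -
  have *: "{1..<length (a # xs)} = insert 1 (Suc ` {1..<length xs})"
    using assms by (auto simp: image_Suc_atLeastLessThan neq_Nil_conv)
  then show ?thesis
    unfolding partial_sums_def * image_insert image_image by simp
qed

lemma partial_sums_subset: "0 \<notin> set xs \<Longrightarrow> partial_sums xs \<subseteq> {1..<sum_list xs}"
proof (induction xs)
  case (Cons a xs)
  show ?case
  proof (cases "xs = []")
    case False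
    then have "sum_list xs > 0" using Cons.prems by (cases xs) auto
    then show ?thesis using Cons False by (fastforce simp: partial_sums_Cons)
  qed simp
qed simp

lemma partial_sums_inj:
  assumes "0 \<notin> set xs" "0 \<notin> set ys" "sum_list xs = sum_list ys"
    "partial_sums xs = partial_sums ys"
  shows "xs = ys"
  using assms
proof (induction xs arbitrary: ys)
  case Nil
  then show ?case by (cases ys) auto
next
  case (Cons a xs)
  then obtain b zs where ys: "ys = b # zs" by (cases ys) auto
  show ?case
  proof (cases "xs = [] \<or> zs = []")
    case True
    then show ?thesis using Cons.prems ys
      by (cases "xs = []"; cases "zs = []") (auto simp: partial_sums_Cons)
  next
    case False
    have eq: "insert a ((+) a ` partial_sums xs) = insert b ((+) b ` partial_sums zs)"
      using Cons.prems(4) ys False by (simp add: partial_sums_Cons)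
    have pos: "\<forall>x\<in>partial_sums xs. x \<ge> 1" "\<forall>x\<in>partial_sums zs. x \<ge> 1"
      using partial_sums_subset[of xs] partial_sums_subset[of zs] Cons.prems ys by force+
    have "a = b"
    proof -
      have "a \<ge> b" using eq pos by (metis image_iff insert_iff le_add1 order_refl)
      moreover have "b \<ge> a" using eq pos by (metis image_iff insert_iff le_add1 order_refl)
      ultimately show ?thesis by simp
    qed
    moreover have "a \<notin> (+) a ` partial_sums xs" "a \<notin> (+) a ` partial_sums zs"
      using pos by force+
    ultimately have "(+) a ` partial_sums xs = (+) a ` partial_sums zs"
      using eq by (metis insert_ident)
    then have "partial_sums xs = partial_sums zs" by (simp add: inj_image_eq_iff)
    then show ?thesis using Cons \<open>a = b\<close> ys by simp
  qed
qed

lemma partial_sums_surj: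
  "S \<subseteq> {1..<n} \<Longrightarrow> \<exists>xs. 0 \<notin> set xs \<and> sum_list xs = n \<and> partial_sums xs = S"
proof (induction n arbitrary: S rule: less_induct)
  case (less n)
  show ?case
  proof (cases "S = {}")
    case True
    show ?thesis
    proof (cases "n = 0")
      case True
      then show ?thesis using \<open>S = {}\<close> by (intro exI[of _ "[]"]) simp
    next
      case False
      then show ?thesis using \<open>S = {}\<close> by (intro exI[of _ "[n]"]) simp
    qed
  next
    case False
    have fin: "finite S" using less.prems finite_subset by blast
    define m where "m = Min S"
    have m: "m \<in> S" "\<forall>x\<in>S. m \<le> x" using False fin by (auto simp: m_def)
    then have mn: "1 \<le> m" "m < n" using less.prems by auto
    define T where "T = (\<lambda>x. x - m) ` (S - {m})"
    have "T \<subseteq> {1..<n - m}" using m less.prems by (fastforce simp: T_def)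
    then obtain xs where xs: "0 \<notin> set xs" "sum_list xs = n - m" "partial_sums xs = T"
      using less.IH[of "n - m" T] mn by auto
    have "xs \<noteq> []" using xs mn by auto
    moreover have "(+) m ` T = S - {m}"
      using m by (force simp: T_def image_image)
    ultimately have "partial_sums (m # xs) = S"
      using xs m by (auto simp: partial_sums_Cons)
    then show ?thesis using xs mn by (intro exI[of _ "m # xs"]) auto
  qed
qed

lemma descents_subset: "descents \<alpha> \<subseteq> {1..<weight \<alpha>}"
  using parts[of \<alpha>] partial_sums_subset by (simp add: descents_def weight_def)

lemma composition_eqI: "weight \<alpha> = weight \<beta> \<Longrightarrow> descents \<alpha> = descents \<beta> \<Longrightarrow> \<alpha> = \<beta>"
  using parts[of \<alpha>] parts[of \<beta>] partial_sums_inj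
  by (auto simp: descents_def weight_def simp flip: parts_inject)

lemma ex1_descents:
  assumes "S \<subseteq> {1..<n}"
  shows "\<exists>!\<alpha>. weight \<alpha> = n \<and> descents \<alpha> = S"
proof -
  obtain xs where xs: "0 \<notin> set xs" "sum_list xs = n" "partial_sums xs = S"
    using partial_sums_surj[OF assms] by blast
  then have "weight (Composition xs) = n \<and> descents (Composition xs) = S"
    by (simp add: weight_def descents_def Composition_inverse)
  then show ?thesis using composition_eqI by blast
qed

text \<open>Reverse inclusion of descent sets: the coarser composition is the larger one.\<close>

instantiation composition :: order
begin

definition less_eq_composition :: "composition \<Rightarrow> composition \<Rightarrow> bool" where
  "\<alpha> \<le> \<beta> \<longleftrightarrow> weight \<alpha> = weight \<beta> \<and> descents \<beta> \<subseteq> descents \<alpha>"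

definition less_composition :: "composition \<Rightarrow> composition \<Rightarrow> bool" where
  "\<alpha> < \<beta> \<longleftrightarrow> \<alpha> \<le> \<beta> \<and> \<not> \<beta> \<le> (\<alpha> :: composition)"

instance
  by standard
    (auto simp: less_eq_composition_def less_composition_def intro: composition_eqI)

end

lemma finite_coarser: "finite {\<beta>. \<beta> \<ge> (\<alpha> :: composition)}"
proof (rule finite_imageD)
  have "finite (descents \<alpha>)" using descents_subset finite_subset by blast
  then show "finite (descents ` {\<beta>. \<beta> \<ge> \<alpha>})"
    by (rule finite_subset[rotated, OF finite_Pow_iff[THEN iffD2]])
      (auto simp: less_eq_composition_def)
  show "inj_on descents {\<beta>. \<beta> \<ge> \<alpha>}"
    by (auto simp: less_eq_composition_def intro!: inj_onI composition_eqI)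
qed

definition compl :: "composition \<Rightarrow> composition" where
  "compl \<alpha> = (THE \<gamma>. weight \<gamma> = weight \<alpha> \<and> descents \<gamma> = {1..<weight \<alpha>} - descents \<alpha>)"

lemma weight_compl: "weight (compl \<alpha>) = weight \<alpha>"
  and descents_compl: "descents (compl \<alpha>) = {1..<weight \<alpha>} - descents \<alpha>"
  using theI'[OF ex1_descents[of "{1..<weight \<alpha>} - descents \<alpha>" "weight \<alpha>"]]
  by (auto simp: compl_def)

definition cstat :: "composition \<Rightarrow> composition \<Rightarrow> nat" where
  "cstat \<alpha> \<beta> = \<Sum>(descents \<alpha> \<inter> descents \<beta>)"


section \<open>Noncommutative symmetric functions\<close>

text \<open>
  A composition is a word in the letters $1, 2, \ldots$, so the monoid algebra of
  compositions under concatenation (convolution product on finitely supported functions)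
  is the free associative algebra on generators $h_1, h_2, \ldots$ over the coefficient
  ring, where $h_n$ is the basis element of the one-letter word $n$.
\<close>

type_synonym 'a ncsym = "composition \<Rightarrow>\<^sub>0 'a"

lift_definition one_part :: "nat \<Rightarrow> composition" is "\<lambda>n. if n = 0 then [] else [n]"
  by simp

definition scale :: "'a::comm_ring_1 \<Rightarrow> 'a ncsym \<Rightarrow> 'a ncsym" where
  "scale c x = Poly_Mapping.single 0 c * x"

definition hsym :: "nat \<Rightarrow> 'a::comm_ring_1 ncsym" where
  "hsym n = Poly_Mapping.single (one_part n) 1"

definition hprod :: "composition \<Rightarrow> 'a::comm_ring_1 ncsym" where
  "hprod \<alpha> = prod_list (map hsym (parts \<alpha>))"

text \<open>The subtraction does not truncate: a coarser composition has at most as many parts.\<close>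

definition ribbon :: "composition \<Rightarrow> 'a::comm_ring_1 ncsym" where
  "ribbon \<alpha> = (\<Sum>\<beta> | \<beta> \<ge> \<alpha>. (-1) ^ (len \<alpha> - len \<beta>) * hprod \<beta>)"

text \<open>
  The parameter \<open>q\<close> ranges over the coefficient ring. The generic function is the case
  where \<open>q\<close> is the indeterminate of a polynomial ring; evaluating its coefficients
  at \<open>z\<close> gives \<open>Hsym z \<alpha>\<close>, see \<open>Hsym_specialization\<close> below.
\<close>

definition Hsym :: "'a::comm_ring_1 \<Rightarrow> composition \<Rightarrow> 'a ncsym" where
  "Hsym q \<alpha> = (\<Sum>\<beta> | \<beta> \<ge> \<alpha>. scale (q ^ cstat \<alpha> (compl \<beta>)) (ribbon \<beta>))"

lemma hprod_eq_single: "hprod \<alpha> = Poly_Mapping.single \<alpha> 1"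
proof -
  have "prod_list (map hsym xs) = Poly_Mapping.single (Composition xs) (1::'a)"
    if "0 \<notin> set xs" for xs
    using that
  proof (induction xs)
    case Nil
    then show ?case by (simp flip: zero_composition_def)
  next
    case (Cons a xs)
    have "one_part a + Composition xs = Composition (a # xs)"
      using Cons.prems
      by (simp add: one_part.rep_eq plus_composition.rep_eq Composition_inverse
          flip: parts_inject)
    then show ?case using Cons by (simp add: hsym_def mult_single)
  qed
  from this[of "parts \<alpha>"] show ?thesis
    using parts[of \<alpha>] by (simp add: hprod_def parts_inverse)
qed

lemma Hsym_specialization:
  fixes z :: "'a::comm_ring_1"
  shows "Poly_Mapping.map (\<lambda>p. poly p z) (Hsym [:0, 1:] \<alpha>) = Hsym z \<alpha>"
proof -
  have sgn: "(-1) ^ n * hprod \<beta> = Poly_Mapping.single \<beta> ((-1) ^ n :: 'b::comm_ring_1)"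
    for n \<beta>
    by (cases "even n") (simp_all add: hprod_eq_single single_uminus)
  have expand: "Hsym q \<alpha> = (\<Sum>\<beta> | \<beta> \<ge> \<alpha>. \<Sum>\<gamma> | \<gamma> \<ge> \<beta>. Poly_Mapping.single \<gamma>
      (q ^ cstat \<alpha> (compl \<beta>) * (-1) ^ (len \<beta> - len \<gamma>)))" for q :: "'b::comm_ring_1"
    by (simp add: Hsym_def ribbon_def scale_def sgn sum_distrib_left mult_single)
  show ?thesis
  proof (rule poly_mapping_eqI)
    fix \<delta>
    have "Poly_Mapping.lookup (Poly_Mapping.map (\<lambda>p. poly p z) (Hsym [:0, 1:] \<alpha>)) \<delta>
        = poly (Poly_Mapping.lookup (Hsym [:0, 1:] \<alpha>) \<delta>) z"
      by (simp add: Poly_Mapping.map.rep_eq when_def)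
    also have "\<dots> = Poly_Mapping.lookup (Hsym z \<alpha>) \<delta>"
      unfolding expand lookup_sum poly_sum lookup_single when_def
      by (intro sum.cong refl) simp
    finally show "Poly_Mapping.lookup (Poly_Mapping.map (\<lambda>p. poly p z) (Hsym [:0, 1:] \<alpha>)) \<delta>
        = Poly_Mapping.lookup (Hsym z \<alpha>) \<delta>" .
  qed
qed

end

theory Submission
  imports Defs
begin

text \<open>
  Inclusion-exclusion over the intermediate descent sets gives
  $H^q_\alpha = \sum_{\gamma \ge \alpha} \prod_{i \in D(\alpha) \setminus D(\gamma)} (q^i - 1)\, h_\gamma$.
  If $\alpha = \beta \cdot \beta'$ with $m = |\beta|$ and $\zeta^m = 1$, the factor
  $\zeta^m - 1$ kills every $\gamma$ with $m \notin D(\gamma)$. The surviving $\gamma$ split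
  uniquely at $m$, and their coefficients factor because $\zeta^{m+i} = \zeta^i$.
\<close>

text \<open>Expanding the product picks \<open>f i\<close> or -1 from each factor; \<open>X\<close>
  collects the indices where \<open>f i\<close> is picked. In \<open>Hsym_expand\<close> the set
  \<open>X\<close> becomes D(\<alpha>) - D(\<beta>).\<close>

lemma prod_sub_one:
  fixes f :: "'b \<Rightarrow> 'a::comm_ring_1"
  assumes "finite A"
  shows "(\<Prod>i\<in>A. f i - 1) = (\<Sum>X\<in>Pow A. prod f X * (-1) ^ card (A - X))"
  using prod_add[OF assms, of f "\<lambda>_. -1"] by simp

section \<open>Weight and length in terms of descents\<close>

lemma finite_descents [simp]: "finite (descents \<alpha>)"
  using descents_subset finite_subset by blast

lemma weight_zero [simp]: "weight 0 = 0"
  by (simp add: weight_def zero_composition.rep_eq)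

lemma weight_plus [simp]: "weight (\<alpha> + \<beta>) = weight \<alpha> + weight \<beta>"
  by (simp add: weight_def plus_composition.rep_eq)

lemma weight_eq_0_iff [simp]: "weight \<alpha> = 0 \<longleftrightarrow> \<alpha> = 0"
proof
  assume "weight \<alpha> = 0"
  then have "parts \<alpha> = []"
    using parts[of \<alpha>] by (cases "parts \<alpha>") (auto simp: weight_def)
  then show "\<alpha> = 0" by (simp add: zero_composition.rep_eq flip: parts_inject)
qed simp

lemma plus_composition_eq_0_iff [simp]: "\<alpha> + \<beta> = 0 \<longleftrightarrow> \<alpha> = 0 \<and> \<beta> = (0 :: composition)"
  by (simp flip: weight_eq_0_iff)

text \<open>Positive parts make the proper prefix sums strictly increasing, hence distinct. The
  truncated subtraction also gives the right value 0 for the empty list.\<close>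

lemma card_partial_sums: "0 \<notin> set xs \<Longrightarrow> card (partial_sums xs) = length xs - 1"
proof (induction xs)
  case (Cons a xs)
  show ?case
  proof (cases "xs = []")
    case False
    have sub: "partial_sums xs \<subseteq> {1..<sum_list xs}"
      using partial_sums_subset Cons.prems by simp
    have "a \<notin> (+) a ` partial_sums xs" using sub by force
    moreover have "finite (partial_sums xs)" using sub finite_subset by blast
    ultimately show ?thesis using Cons False
      by (cases xs) (simp_all add: partial_sums_Cons card_image)
  qed simp
qed simp

lemma card_descents: "card (descents \<alpha>) = len \<alpha> - 1"
  using parts[of \<alpha>] by (simp add: descents_def len_def card_partial_sums)

lemma len_eq_card_descents: "\<alpha> \<noteq> 0 \<Longrightarrow> len \<alpha> = Suc (card (descents \<alpha>))"
  by (cases "parts \<alpha>")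
    (auto simp: card_descents len_def zero_composition.rep_eq simp flip: parts_inject)

text \<open>This turns the sign exponent of \<open>ribbon\<close> into the size of a set of
  descents, the form inclusion-exclusion produces. For nonempty compositions each length is one more
  than the number of descents, and the ones cancel; the empty composition is comparable only to
  itself.\<close>

lemma len_diff_coarser:
  assumes "\<beta> \<le> \<gamma>"
  shows "len \<beta> - len \<gamma> = card (descents \<beta> - descents \<gamma>)"
proof (cases "\<beta> = 0")
  case True
  then have "\<gamma> = 0" using assms by (simp add: less_eq_composition_def flip: weight_eq_0_iff)
  then show ?thesis using True by simp
next
  case False
  then have "\<gamma> \<noteq> 0" using assms
    by (metis less_eq_composition_def weight_eq_0_iff)
  then show ?thesis using assms False
    by (simp add: len_eq_card_descents card_Diff_subset less_eq_composition_def)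
qed

section \<open>Descent sets and order under concatenation\<close>

lemma partial_sums_append:
  assumes "xs \<noteq> []" "ys \<noteq> []"
  shows "partial_sums (xs @ ys) =
    partial_sums xs \<union> insert (sum_list xs) ((+) (sum_list xs) ` partial_sums ys)"
  using assms(1)
proof (induction xs)
  case (Cons a xs)
  then show ?case using assms(2)
    by (cases "xs = []") (auto simp: partial_sums_Cons image_Un image_image add.assoc)
qed simp

text \<open>The junction of two nonempty compositions is itself a descent. With an empty factor it
  would sit at 0 or at the total weight, where no descent can be.\<close>

lemma descents_plus:
  assumes "\<alpha> \<noteq> 0" "\<beta> \<noteq> 0"
  shows "descents (\<alpha> + \<beta>) =
    descents \<alpha> \<union> insert (weight \<alpha>) ((+) (weight \<alpha>) ` descents \<beta>)"
  using assms partial_sums_append[of "parts \<alpha>" "parts \<beta>"]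
  by (simp add: descents_def weight_def plus_composition.rep_eq zero_composition.rep_eq
      flip: parts_inject)

text \<open>A descent is a prefix sum, so cutting the parts at that prefix gives the two
  factors.\<close>

lemma descents_split:
  assumes "m \<in> descents \<gamma>"
  obtains \<beta> \<beta>' where "\<gamma> = \<beta> + \<beta>'" "weight \<beta> = m"
proof -
  obtain i where i: "m = sum_list (take i (parts \<gamma>))"
    using assms by (auto simp: descents_def partial_sums_def)
  have p: "0 \<notin> set (take i (parts \<gamma>))" "0 \<notin> set (drop i (parts \<gamma>))"
    using parts[of \<gamma>] by (auto dest: in_set_takeD in_set_dropD)
  show thesis
  proof (rule that)
    show "\<gamma> = Composition (take i (parts \<gamma>)) + Composition (drop i (parts \<gamma>))"
      using p by (simp add: plus_composition.rep_eq Composition_inverse flip: parts_inject)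
    show "weight (Composition (take i (parts \<gamma>))) = m"
      using p i by (simp add: weight_def Composition_inverse)
  qed
qed

text \<open>Both concatenations have their junction at \<open>weight \<alpha>\<close>, so it
  cancels. Descents of the left factors lie below this point and shifted descents of the right
  factors above it, so the two sides do not interact.\<close>

lemma descents_plus_diff:
  assumes "weight \<gamma> = weight \<alpha>" "weight \<delta> = weight \<beta>" "\<alpha> \<noteq> 0" "\<beta> \<noteq> 0"
  shows "descents (\<alpha> + \<beta>) - descents (\<gamma> + \<delta>) =
    (descents \<alpha> - descents \<gamma>) \<union> (+) (weight \<alpha>) ` (descents \<beta> - descents \<delta>)"
proof -
  have "\<gamma> \<noteq> 0" "\<delta> \<noteq> 0" using assms by (metis weight_eq_0_iff)+
  then have eqs: "descents (\<alpha> + \<beta>) =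
      descents \<alpha> \<union> insert (weight \<alpha>) ((+) (weight \<alpha>) ` descents \<beta>)"
    "descents (\<gamma> + \<delta>) =
      descents \<gamma> \<union> insert (weight \<alpha>) ((+) (weight \<alpha>) ` descents \<delta>)"
    using assms by (simp_all only: descents_plus not_False_eq_True)
  have disj: "descents \<alpha> \<inter> insert (weight \<alpha>) ((+) (weight \<alpha>) ` descents \<delta>) = {}"
    "descents \<gamma> \<inter> (+) (weight \<alpha>) ` descents \<beta> = {}"
    using assms(1) descents_subset[of \<alpha>] descents_subset[of \<gamma>] by force+
  have notin: "weight \<alpha> \<notin> (+) (weight \<alpha>) ` descents \<beta>"
    using descents_subset[of \<beta>] by force
  have "(+) (weight \<alpha>) ` (descents \<beta> - descents \<delta>) =
      (+) (weight \<alpha>) ` descents \<beta> - (+) (weight \<alpha>) ` descents \<delta>"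
    by (rule image_set_diff) simp
  then show ?thesis unfolding eqs using disj notin by auto
qed

text \<open>For equal weights the order says that a difference of descent sets is empty, and
  \<open>descents_plus_diff\<close> splits this difference into one piece per factor.\<close>

lemma plus_le_plus_iff:
  fixes \<alpha> \<beta> \<gamma> \<delta> :: composition
  assumes "weight \<gamma> = weight \<alpha>" "weight \<delta> = weight \<beta>" "\<alpha> \<noteq> 0" "\<beta> \<noteq> 0"
  shows "\<alpha> + \<beta> \<le> \<gamma> + \<delta> \<longleftrightarrow> \<alpha> \<le> \<gamma> \<and> \<beta> \<le> \<delta>"
proof -
  have nz: "\<gamma> \<noteq> 0" "\<delta> \<noteq> 0" using assms by (metis weight_eq_0_iff)+
  have "descents (\<gamma> + \<delta>) - descents (\<alpha> + \<beta>) = {} \<longleftrightarrow>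
      descents \<gamma> \<subseteq> descents \<alpha> \<and> descents \<delta> \<subseteq> descents \<beta>"
    using assms nz by (subst descents_plus_diff) auto
  then show ?thesis using assms by (auto simp: less_eq_composition_def)
qed

text \<open>Equality amounts to two inequalities; \<open>plus_le_plus_iff\<close> passes both to the
  factors, where antisymmetry applies.\<close>

lemma plus_composition_inj:
  fixes \<alpha> \<beta> \<gamma> \<delta> :: composition
  assumes "\<alpha> + \<beta> = \<gamma> + \<delta>" "weight \<alpha> = weight \<gamma>" "\<alpha> \<noteq> 0" "\<beta> \<noteq> 0"
  shows "\<alpha> = \<gamma> \<and> \<beta> = \<delta>"
proof -
  have "weight \<beta> = weight \<delta>" using arg_cong[OF assms(1), of weight] assms(2) by simp
  moreover have "\<gamma> \<noteq> 0" "\<delta> \<noteq> 0" using assms calculation by (metis weight_eq_0_iff)+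
  ultimately show ?thesis
    using assms plus_le_plus_iff[of \<alpha> \<gamma> \<beta> \<delta>] plus_le_plus_iff[of \<gamma> \<alpha> \<delta> \<beta>]
    by (metis order.antisym order.refl)
qed

section \<open>Expansion in the basis of products of complete functions\<close>

lemma single_sum:
  "Poly_Mapping.single k (sum f A) = (\<Sum>x\<in>A. Poly_Mapping.single k (f x))"
  by (induction A rule: infinite_finite_induct) (simp_all add: single_add)

lemma Hsym_expand:
  fixes q :: "'a::comm_ring_1"
  shows "Hsym q \<alpha> = (\<Sum>\<gamma> | \<gamma> \<ge> \<alpha>.
    Poly_Mapping.single \<gamma> (\<Prod>i\<in>descents \<alpha> - descents \<gamma>. q ^ i - 1))"
proof -
  have sgn: "(-1) ^ n * hprod \<beta> = Poly_Mapping.single \<beta> ((-1) ^ n :: 'a)" for n \<beta>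
    by (cases "even n") (simp_all add: hprod_eq_single single_uminus)
  let ?c = "\<lambda>\<beta> \<gamma>. q ^ cstat \<alpha> (compl \<beta>) * (-1) ^ (len \<beta> - len \<gamma>)"
  \<comment> \<open>After the two summations are exchanged, the coefficient at \<gamma> is a sum
    over the interval from \<alpha> to \<gamma>.\<close>
  have coeff: "(\<Sum>\<beta> | \<alpha> \<le> \<beta> \<and> \<beta> \<le> \<gamma>. ?c \<beta> \<gamma>) =
      (\<Prod>i\<in>descents \<alpha> - descents \<gamma>. q ^ i - 1)" if "\<alpha> \<le> \<gamma>" for \<gamma>
  proof -
    let ?A = "descents \<alpha>" and ?G = "descents \<gamma>"
    have GA: "?G \<subseteq> ?A" "weight \<gamma> = weight \<alpha>"
      using that by (auto simp: less_eq_composition_def)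
    \<comment> \<open>A composition in the interval is determined by the descents of \<alpha> that
      it drops, and these can be any subset of D(\<alpha>) - D(\<gamma>).\<close>
    have bij: "bij_betw (\<lambda>\<beta>. ?A - descents \<beta>) {\<beta>. \<alpha> \<le> \<beta> \<and> \<beta> \<le> \<gamma>} (Pow (?A - ?G))"
    proof (rule bij_betwI')
      fix \<beta> \<beta>' assume "\<beta> \<in> {\<beta>. \<alpha> \<le> \<beta> \<and> \<beta> \<le> \<gamma>}" "\<beta>' \<in> {\<beta>. \<alpha> \<le> \<beta> \<and> \<beta> \<le> \<gamma>}"
      then have "weight \<beta> = weight \<beta>'" "descents \<beta> \<subseteq> ?A" "descents \<beta>' \<subseteq> ?A"
        unfolding less_eq_composition_def mem_Collect_eq by metis+
      then show "(?A - descents \<beta> = ?A - descents \<beta>') = (\<beta> = \<beta>')"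
        by (metis composition_eqI double_diff subset_refl)
    next
      fix \<beta> assume "\<beta> \<in> {\<beta>. \<alpha> \<le> \<beta> \<and> \<beta> \<le> \<gamma>}"
      then show "?A - descents \<beta> \<in> Pow (?A - ?G)"
        by (auto simp: less_eq_composition_def)
    next
      fix X assume X: "X \<in> Pow (?A - ?G)"
      have "?A - X \<subseteq> {1..<weight \<alpha>}" using descents_subset by blast
      then obtain \<beta> where \<beta>: "weight \<beta> = weight \<alpha>" "descents \<beta> = ?A - X"
        using ex1_implies_ex[OF ex1_descents] by metis
      show "\<exists>\<beta>\<in>{\<beta>. \<alpha> \<le> \<beta> \<and> \<beta> \<le> \<gamma>}. X = ?A - descents \<beta>"
        using X GA \<beta> by (intro bexI[of _ \<beta>]) (auto simp: less_eq_composition_def)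
    qed
    have c: "?c \<beta> \<gamma> = (\<Prod>i\<in>?A - descents \<beta>. q ^ i) *
        (-1) ^ card ((?A - ?G) - (?A - descents \<beta>))"
      if \<beta>: "\<beta> \<in> {\<beta>. \<alpha> \<le> \<beta> \<and> \<beta> \<le> \<gamma>}" for \<beta>
    proof -
      \<comment> \<open>The exponent \<open>cstat \<alpha> (compl \<beta>)\<close> is thus the sum
        of the dropped descents, so the power of \<open>q\<close> becomes a product over
        them.\<close>
      have "?A \<inter> descents (compl \<beta>) = ?A - descents \<beta>"
        using \<beta> descents_subset[of \<alpha>] by (auto simp: descents_compl less_eq_composition_def)
      moreover have "(?A - ?G) - (?A - descents \<beta>) = descents \<beta> - ?G"
        using \<beta> by (auto simp: less_eq_composition_def)
      ultimately show ?thesis using \<beta>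
        by (simp add: cstat_def power_sum len_diff_coarser)
    qed
    have "(\<Sum>\<beta> | \<alpha> \<le> \<beta> \<and> \<beta> \<le> \<gamma>. ?c \<beta> \<gamma>) = (\<Sum>\<beta> | \<alpha> \<le> \<beta> \<and> \<beta> \<le> \<gamma>.
        (\<Prod>i\<in>?A - descents \<beta>. q ^ i) * (-1) ^ card ((?A - ?G) - (?A - descents \<beta>)))"
      by (rule sum.cong[OF refl c])
    also have "\<dots> = (\<Sum>X\<in>Pow (?A - ?G). (\<Prod>i\<in>X. q ^ i) * (-1) ^ card ((?A - ?G) - X))"
      by (rule sum.reindex_bij_betw[OF bij])
    finally show ?thesis by (simp add: prod_sub_one)
  qed
  have "Hsym q \<alpha> = (\<Sum>\<beta> | \<alpha> \<le> \<beta>. \<Sum>\<gamma> | \<beta> \<le> \<gamma>. Poly_Mapping.single \<gamma> (?c \<beta> \<gamma>))"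
    by (simp add: Hsym_def ribbon_def scale_def sgn sum_distrib_left mult_single)
  \<comment> \<open>The condition \<alpha> \<le> \<gamma> follows by transitivity. Stating it lets
    both indices range over the same finite set, restricted by \<beta> \<le> \<gamma>, so that the
    sums can be exchanged.\<close>
  also have "\<dots> = (\<Sum>\<beta> | \<alpha> \<le> \<beta>. \<Sum>\<gamma> | \<alpha> \<le> \<gamma> \<and> \<beta> \<le> \<gamma>. Poly_Mapping.single \<gamma> (?c \<beta> \<gamma>))"
    by (intro sum.cong refl arg_cong2[where f = sum]) (auto intro: order_trans)
  also have "\<dots> = (\<Sum>\<gamma> | \<alpha> \<le> \<gamma>. \<Sum>\<beta> | \<alpha> \<le> \<beta> \<and> \<beta> \<le> \<gamma>. Poly_Mapping.single \<gamma> (?c \<beta> \<gamma>))"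
    using sum.swap_restrict[OF finite_coarser[of \<alpha>] finite_coarser[of \<alpha>],
        of "\<lambda>\<beta> \<gamma>. Poly_Mapping.single \<gamma> (?c \<beta> \<gamma>)" "(\<le>)"] by simp
  also have "\<dots> = (\<Sum>\<gamma> | \<alpha> \<le> \<gamma>. Poly_Mapping.single \<gamma> (\<Sum>\<beta> | \<alpha> \<le> \<beta> \<and> \<beta> \<le> \<gamma>. ?c \<beta> \<gamma>))"
    by (simp add: single_sum)
  also have "\<dots> = (\<Sum>\<gamma> | \<alpha> \<le> \<gamma>.
      Poly_Mapping.single \<gamma> (\<Prod>i\<in>descents \<alpha> - descents \<gamma>. q ^ i - 1))"
    by (simp add: coeff)
  finally show ?thesis .
qed

section \<open>Factorization at a root of unity\<close>

lemma Hsym_plus: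
  fixes q :: "'a::comm_ring_1"
  assumes root: "q ^ weight \<alpha> = 1" and nz: "\<alpha> \<noteq> 0" "\<beta> \<noteq> 0"
  shows "Hsym q (\<alpha> + \<beta>) = Hsym q \<alpha> * Hsym q \<beta>"
proof -
  let ?c = "\<lambda>\<alpha> \<gamma>. \<Prod>i\<in>descents \<alpha> - descents \<gamma>. q ^ i - 1"
  let ?P = "{\<gamma>. \<alpha> \<le> \<gamma>} \<times> {\<delta>. \<beta> \<le> \<delta>}"
  let ?S = "{\<gamma>. \<alpha> + \<beta> \<le> \<gamma> \<and> weight \<alpha> \<in> descents \<gamma>}"
  have wt: "weight \<gamma> = weight \<alpha>" "weight \<delta> = weight \<beta>" "\<gamma> \<noteq> 0" "\<delta> \<noteq> 0"
    if "(\<gamma>, \<delta>) \<in> ?P" for \<gamma> \<delta>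
    using that nz by (auto simp: less_eq_composition_def simp flip: weight_eq_0_iff)
  \<comment> \<open>Coarsenings of \<alpha> + \<beta> that keep the junction as a descent are
    exactly the concatenations of a coarsening of \<alpha> with one of \<beta>.\<close>
  have bij: "bij_betw (\<lambda>(\<gamma>, \<delta>). \<gamma> + \<delta>) ?P ?S"
    unfolding bij_betw_def
  proof
    show "inj_on (\<lambda>(\<gamma>, \<delta>). \<gamma> + \<delta>) ?P"
    proof (rule inj_onI)
      fix p p' assume p: "p \<in> ?P" "p' \<in> ?P"
        and eq: "(\<lambda>(\<gamma>, \<delta>). \<gamma> + \<delta>) p = (\<lambda>(\<gamma>, \<delta>). \<gamma> + \<delta>) p'"
      obtain \<gamma> \<delta> \<gamma>' \<delta>' where pp: "p = (\<gamma>, \<delta>)" "p' = (\<gamma>', \<delta>')" by fastforce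
      have "\<gamma> = \<gamma>' \<and> \<delta> = \<delta>'"
        using plus_composition_inj[of \<gamma> \<delta> \<gamma>' \<delta>'] eq p[unfolded pp, THEN wt(1)]
          wt(3,4)[OF p(1)[unfolded pp]] by (simp add: pp)
      then show "p = p'" by (simp add: pp)
    qed
    show "(\<lambda>(\<gamma>, \<delta>). \<gamma> + \<delta>) ` ?P = ?S"
    proof (intro equalityI subsetI)
      fix \<epsilon> assume "\<epsilon> \<in> (\<lambda>(\<gamma>, \<delta>). \<gamma> + \<delta>) ` ?P"
      then obtain \<gamma> \<delta> where "(\<gamma>, \<delta>) \<in> ?P" "\<epsilon> = \<gamma> + \<delta>" by auto
      then show "\<epsilon> \<in> ?S"
        using wt[of \<gamma> \<delta>] nz by (simp add: plus_le_plus_iff descents_plus)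
    next
      fix \<epsilon> assume e: "\<epsilon> \<in> ?S"
      then have "weight \<alpha> \<in> descents \<epsilon>" by simp
      then obtain \<gamma> \<delta> where gd: "\<epsilon> = \<gamma> + \<delta>" "weight \<gamma> = weight \<alpha>"
        by (rule descents_split)
      moreover have "weight \<delta> = weight \<beta>"
        using e gd by (simp add: less_eq_composition_def)
      ultimately have "(\<gamma>, \<delta>) \<in> ?P" using e nz by (simp add: plus_le_plus_iff)
      then show "\<epsilon> \<in> (\<lambda>(\<gamma>, \<delta>). \<gamma> + \<delta>) ` ?P" using gd by force
    qed
  qed
  have c_plus: "?c (\<alpha> + \<beta>) (\<gamma> + \<delta>) = ?c \<alpha> \<gamma> * ?c \<beta> \<delta>" if "(\<gamma>, \<delta>) \<in> ?P" for \<gamma> \<delta>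
  proof -
    have disj: "(descents \<alpha> - descents \<gamma>) \<inter> (+) (weight \<alpha>) ` (descents \<beta> - descents \<delta>) = {}"
      using descents_subset[of \<alpha>] by force
    \<comment> \<open>The shift by \<open>weight \<alpha>\<close> multiplies each power of
      \<open>q\<close> by \<open>q ^ weight \<alpha>\<close>, which is 1.\<close>
    have "(\<Prod>i\<in>(+) (weight \<alpha>) ` (descents \<beta> - descents \<delta>). q ^ i - 1) = ?c \<beta> \<delta>"
      by (simp add: prod.reindex power_add root)
    then show ?thesis using wt[OF that] nz disj
      by (simp add: descents_plus_diff prod.union_disjoint)
  qed
  \<comment> \<open>The junction is a descent of \<alpha> + \<beta>; if \<gamma> drops it, it
    contributes the factor \<open>q ^ weight \<alpha> - 1\<close>, which is 0.\<close>
  have c_zero: "?c (\<alpha> + \<beta>) \<gamma> = 0" if "weight \<alpha> \<notin> descents \<gamma>" for \<gamma>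
    by (rule prod_zero) (use that nz root in \<open>auto simp: descents_plus intro!: bexI[of _ "weight \<alpha>"]\<close>)
  have "Hsym q (\<alpha> + \<beta>) = (\<Sum>\<gamma>\<in>?S. Poly_Mapping.single \<gamma> (?c (\<alpha> + \<beta>) \<gamma>))"
    unfolding Hsym_expand
    by (rule sum.mono_neutral_right) (auto simp: finite_coarser c_zero)
  also have "\<dots> = (\<Sum>(\<gamma>, \<delta>)\<in>?P. Poly_Mapping.single (\<gamma> + \<delta>) (?c (\<alpha> + \<beta>) (\<gamma> + \<delta>)))"
    by (subst sum.reindex_bij_betw[OF bij, symmetric]) (simp add: case_prod_unfold)
  also have "\<dots> = (\<Sum>(\<gamma>, \<delta>)\<in>?P. Poly_Mapping.single \<gamma> (?c \<alpha> \<gamma>) * Poly_Mapping.single \<delta> (?c \<beta> \<delta>))"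
    by (rule sum.cong) (auto simp: c_plus mult_single)
  also have "\<dots> = Hsym q \<alpha> * Hsym q \<beta>"
    by (simp add: Hsym_expand sum_product sum.cartesian_product)
  finally show ?thesis .
qed

theorem theorem13:
  fixes r :: nat and \<zeta> :: "'a::field_char_0"
    and \<alpha> :: composition and \<alpha>s :: "composition list"
  assumes "r \<ge> 1" and "\<zeta> ^ r = 1"
    and "\<alpha>s \<noteq> []" and "\<forall>i<length \<alpha>s. \<alpha>s ! i \<noteq> 0"
    and "\<alpha> = sum_list \<alpha>s"
    and "\<forall>i<length \<alpha>s - 1. r dvd weight (\<alpha>s ! i)"
  shows "Hsym \<zeta> \<alpha> = prod_list (map (Hsym \<zeta>) \<alpha>s)"
  unfolding assms(5) using assms(3,4,6)
\<comment> \<open>Each step splits off the first composition. It is not the last one, so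
  divisibility of its weight is available for \<open>Hsym_plus\<close>.\<close>
proof (induction \<alpha>s rule: list_nonempty_induct)
  case (single \<beta>)
  show ?case by simp
next
  case (cons \<beta> \<beta>s)
  have "\<forall>i<length \<beta>s. \<beta>s ! i \<noteq> 0" using cons.prems(1) by fastforce
  \<comment> \<open>Entry \<open>i\<close> of the tail is entry \<open>Suc i\<close> of the whole
    list, and both lists end in the same exempt entry.\<close>
  moreover have "\<forall>i<length \<beta>s - 1. r dvd weight (\<beta>s ! i)"
  proof (intro allI impI)
    fix i assume "i < length \<beta>s - 1"
    then show "r dvd weight (\<beta>s ! i)"
      using cons.prems(2)[rule_format, of "Suc i"] by simp
  qed
  ultimately have IH: "Hsym \<zeta> (sum_list \<beta>s) = prod_list (map (Hsym \<zeta>) \<beta>s)"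
    by (rule cons.IH)
  have "r dvd weight \<beta>"
    using cons.prems(2)[rule_format, of 0] cons.hyps by simp
  then have "\<zeta> ^ weight \<beta> = 1" using assms(2) by (auto simp: dvd_def power_mult)
  moreover have "\<beta> \<noteq> 0" using cons.prems(1) by force
  \<comment> \<open>\<open>Hsym_plus\<close> requires a nonempty right factor; concatenation never
    cancels, so one nonempty entry of the tail suffices.\<close>
  moreover have "sum_list \<beta>s \<noteq> 0"
    using cons.hyps \<open>\<forall>i<length \<beta>s. \<beta>s ! i \<noteq> 0\<close> by (cases \<beta>s) auto
  ultimately show ?case by (simp add: Hsym_plus IH)
qed

end
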